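(* Let $A=(a_{ij})$ be a generic $n\times n$ matrix. Then the apolar ideal $\mathrm{Ann}(\det(A))\subset S$ equals the ideal $(\mathcal P_D+\mathcal U_D)$ of $S$ generated by $\mathcal P_D+\mathcal U_D$; in particular it is generated in degree two.
   Context: Let $\mathsf k$ be a field of characteristic zero or of characteristic $p>2$. A generic $n\times n$ matrix $A=(a_{ij})$ is one whose entries are $n^2$ distinct variables. Put $R=\mathsf k[a_{ij}]$ and $S=\mathsf k[d_{ij}]$ ($1\le i,j\le n$), polynomial rings with the standard grading, and $D=(d_{ij})$. $S$ acts on $R$ by contraction: $\prod d_{ij}^{\alpha_{ij}}\circ\prod a_{ij}^{\beta_{ij}}=\prod a_{ij}^{\beta_{ij}-\alpha_{ij}}$ if $\alpha_{ij}\le\beta_{ij}$ for all $i,j$, and $0$ otherwise, extended $\mathsf k$-bilinearly. For $F\in R$ homogeneous, $\mathrm{Ann}(F)=\{\Phi\in S:\Phi\circ F=0\}$ is the apolar ideal of $F$. $\mathcal P_D\subset S_2$ is the $\mathsf k$-span of all $2\times2$ permanents $d_{ij}d_{kl}+d_{il}d_{kj}$ ($i\ne k$, $j\neq l$) of $D$. A monomial in $S$ is acceptable if it is square free and has no two variables from the same row or column of $D$, and unacceptable otherwise; $\mathcal U_D\subset S_2$ is the $\mathsf k$-span of the unacceptable monomials of degree 2. *)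

theory Defs
  imports "HOL-Analysis.Analysis" "HOL-Library.Poly_Mapping" "HOL-Library.Set_Algebras"
begin

text \<open>
  Exponent vectors and polynomials over \<open>'k\<close> in the variables indexed by the positions
  \<open>(i, j)\<close> of an \<open>n \<times> n\<close> matrix, where \<open>n = CARD('n)\<close>. Their product
  is the convolution product from \<^theory>\<open>HOL-Library.Poly_Mapping\<close>. The rings \<open>R = k[a\<^sub>i\<^sub>j]\<close> and
  \<open>S = k[d\<^sub>i\<^sub>j]\<close> differ only in the names of their variables and share this type.
\<close>

type_synonym 'n expo = "('n \<times> 'n) \<Rightarrow>\<^sub>0 nat"
type_synonym ('n, 'k) mpoly = "'n expo \<Rightarrow>\<^sub>0 'k"

definition monomial :: "'n expo \<Rightarrow> ('n, 'k::field) mpoly" where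
  "monomial \<alpha> = Poly_Mapping.single \<alpha> 1"

definition var :: "'n \<Rightarrow> 'n \<Rightarrow> ('n, 'k::field) mpoly" where
  "var i j = monomial (Poly_Mapping.single (i, j) 1)"

definition generic_matrix :: "('n, 'k::field) mpoly ^ 'n ^ 'n::finite" where
  "generic_matrix = (\<chi> i j. var i j)"

definition mdeg :: "'n expo \<Rightarrow> nat" where
  "mdeg \<alpha> = (\<Sum>v\<in>Poly_Mapping.keys \<alpha>. Poly_Mapping.lookup \<alpha> v)"

definition homogeneous :: "nat \<Rightarrow> ('n, 'k::field) mpoly set" where
  "homogeneous d = {p. \<forall>\<alpha>\<in>Poly_Mapping.keys p. mdeg \<alpha> = d}"

definition scale :: "'k \<Rightarrow> ('n, 'k::field) mpoly \<Rightarrow> ('n, 'k) mpoly" where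
  "scale c p = Poly_Mapping.map ((*) c) p"

lemma lookup_scale [simp]: "Poly_Mapping.lookup (scale c p) \<alpha> = c * Poly_Mapping.lookup p \<alpha>"
  by (simp add: scale_def Poly_Mapping.map.rep_eq when_def)

lemma vector_space_scale: "vector_space (scale :: 'k::field \<Rightarrow> ('n, 'k) mpoly \<Rightarrow> ('n, 'k) mpoly)"
  by unfold_locales (auto intro!: poly_mapping_eqI simp: lookup_add algebra_simps)

lemma module_times: "module ((*) :: ('n, 'k::field) mpoly \<Rightarrow> ('n, 'k) mpoly \<Rightarrow> ('n, 'k) mpoly)"
  by unfold_locales (simp_all add: algebra_simps)

definition kspan :: "('n, 'k::field) mpoly set \<Rightarrow> ('n, 'k) mpoly set" where
  "kspan B = module.span scale B"

text \<open>Ideals are the submodules of the polynomial ring, regarded as a module over itself.\<close>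

definition ideal_gen :: "('n, 'k::field) mpoly set \<Rightarrow> ('n, 'k) mpoly set" where
  "ideal_gen B = module.span (*) B"

definition generated_in_degree :: "nat \<Rightarrow> ('n, 'k::field) mpoly set \<Rightarrow> bool" where
  "generated_in_degree d I \<longleftrightarrow> (\<exists>G \<subseteq> homogeneous d. I = ideal_gen G)"

text \<open>
  Divisibility of monomials is the pointwise order on exponents; the order \<open>\<le>\<close> that
  \<^theory>\<open>HOL-Library.Poly_Mapping\<close> puts on finitely supported functions is a lexicographic one.
\<close>

definition expo_le :: "'n expo \<Rightarrow> 'n expo \<Rightarrow> bool" where
  "expo_le \<alpha> \<beta> \<longleftrightarrow> (\<forall>v. Poly_Mapping.lookup \<alpha> v \<le> Poly_Mapping.lookup \<beta> v)"

definition contract_monomial :: "'n expo \<Rightarrow> 'n expo \<Rightarrow> ('n, 'k::field) mpoly" where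
  "contract_monomial \<alpha> \<beta> = (if expo_le \<alpha> \<beta> then monomial (\<beta> - \<alpha>) else 0)"

definition contract :: "('n, 'k::field) mpoly \<Rightarrow> ('n, 'k) mpoly \<Rightarrow> ('n, 'k) mpoly" where
  "contract \<Phi> F = (\<Sum>\<alpha>\<in>Poly_Mapping.keys \<Phi>. \<Sum>\<beta>\<in>Poly_Mapping.keys F.
     scale (Poly_Mapping.lookup \<Phi> \<alpha> * Poly_Mapping.lookup F \<beta>) (contract_monomial \<alpha> \<beta>))"

lemma contract_monomials: "contract (monomial \<alpha>) (monomial \<beta>) = contract_monomial \<alpha> \<beta>"
  by (auto simp: contract_def monomial_def intro!: poly_mapping_eqI)

definition Ann :: "('n, 'k::field) mpoly \<Rightarrow> ('n, 'k) mpoly set" where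
  "Ann F = {\<Phi>. contract \<Phi> F = 0}"

definition perm_space :: "('n, 'k::field) mpoly ^ 'n ^ 'n::finite \<Rightarrow> ('n, 'k) mpoly set" where
  "perm_space D = kspan {D $ i $ j * D $ k $ l + D $ i $ l * D $ k $ j | i j k l. i \<noteq> k \<and> j \<noteq> l}"

definition acceptable :: "'n expo \<Rightarrow> bool" where
  "acceptable \<alpha> \<longleftrightarrow>
     (\<forall>v. Poly_Mapping.lookup \<alpha> v \<le> 1) \<and>
     (\<forall>v\<in>Poly_Mapping.keys \<alpha>. \<forall>w\<in>Poly_Mapping.keys \<alpha>. v \<noteq> w \<longrightarrow> fst v \<noteq> fst w \<and> snd v \<noteq> snd w)"

definition unacceptable_space :: "('n, 'k::field) mpoly set" where
  "unacceptable_space = kspan {monomial \<alpha> | \<alpha>. mdeg \<alpha> = 2 \<and> \<not> acceptable \<alpha>}"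

end

(* A polynomial annihilates F iff all the pairings of its coefficients with shifted
   coefficients of F vanish. Conversely, let Phi annihilate det A. Its unacceptable terms lie in
   the ideal. An acceptable term alpha extends to a permutation monomial alpha + gamma, and the
   vanishing of the coefficient of gamma in Phi o det A forces a second term alpha' of Phi that
   gamma also completes to a permutation. Exchanging two column indices changes a monomial into its
   negative modulo the permanents, so alpha and alpha' agree up to sign modulo the ideal, and
   alpha' can be eliminated; this lowers the number of terms. *)

theory Submission
  imports Defs
begin

section \<open>Module structures, induction on polynomials and degrees of monomials\<close>

interpretation kmod: module "scale :: 'k::field \<Rightarrow> ('n, 'k) mpoly \<Rightarrow> ('n, 'k) mpoly"
  by (simp add: module_iff_vector_space vector_space_scale)

interpretation imod: module "(*) :: ('n, 'k::field) mpoly \<Rightarrow> ('n, 'k) mpoly \<Rightarrow> ('n, 'k) mpoly"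
  by (rule module_times)

text \<open>Writing a value at a fresh key amounts to adding a single term, so statements additive
  in \<open>p\<close> need checking only on single terms.\<close>

lemma poly_mapping_induct [case_names single add]:
  fixes p :: "'a \<Rightarrow>\<^sub>0 'b::comm_monoid_add"
  assumes single: "\<And>a b. P (Poly_Mapping.single a b)"
    and add: "\<And>p q. P p \<Longrightarrow> P q \<Longrightarrow> P (p + q)"
  shows "P p"
proof (induction p rule: update_induct)
  case const
  show ?case using single[of undefined 0] by simp
next
  case (update p a b)
  have "Poly_Mapping.update a b p = Poly_Mapping.single a b + p"
    using update(1) by (intro poly_mapping_eqI)
      (auto simp: lookup_update lookup_add lookup_single when_def in_keys_iff)
  with update(3) show ?case by (simp add: single add)
qed

text \<open>Scalars act as constant polynomials. This makes every ideal a
  \<open>'k\<close>-subspace, and it reduces coefficients of a constant multiple to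
  \<open>lookup_scale\<close>.\<close>

lemma scale_eq_times: "scale c p = Poly_Mapping.single 0 c * p"
proof (induction p rule: poly_mapping_induct)
  case (single \<alpha> d)
  show ?case
    by (intro poly_mapping_eqI) (simp add: Poly_Mapping.mult_single lookup_single when_def)
next
  case (add p q)
  then show ?case
    by (simp add: kmod.scale_right_distrib distrib_left)
qed

lemma monomial_mult: "monomial (\<alpha> + \<beta>) = (monomial \<alpha> * monomial \<beta> :: ('n, 'k::field) mpoly)"
  by (simp add: monomial_def Poly_Mapping.mult_single)

lemma lookup_monomial: "Poly_Mapping.lookup (monomial \<alpha>) \<beta> = (if \<alpha> = \<beta> then 1 else 0)"
  by (simp add: monomial_def lookup_single when_def)

lemma mdeg_eq_sum:
  assumes "finite V" "Poly_Mapping.keys \<alpha> \<subseteq> V"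
  shows "mdeg \<alpha> = (\<Sum>v\<in>V. Poly_Mapping.lookup \<alpha> v)"
  unfolding mdeg_def using assms by (intro sum.mono_neutral_left) (auto simp: in_keys_iff)

lemma mdeg_add: "mdeg (\<alpha> + \<beta>) = mdeg \<alpha> + mdeg \<beta>"
proof -
  let ?V = "Poly_Mapping.keys \<alpha> \<union> Poly_Mapping.keys \<beta>"
  have "Poly_Mapping.keys (\<alpha> + \<beta>) \<subseteq> ?V"
    by (rule Poly_Mapping.keys_add)
  then show ?thesis
    by (simp add: mdeg_eq_sum[of ?V] lookup_add sum.distrib)
qed

lemma mdeg_single [simp]: "mdeg (Poly_Mapping.single v m) = m"
  by (simp add: mdeg_def)

subsection \<open>Contraction in terms of coefficients\<close>

text \<open>This is the coefficient of \<gamma> in the contraction of F by \<Phi>. It is linear in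
  \<Phi> and involves only sums of exponents, never truncated differences.\<close>

definition shifted_pairing :: "('n, 'k::field) mpoly \<Rightarrow> 'n expo \<Rightarrow> ('n, 'k) mpoly \<Rightarrow> 'k" where
  "shifted_pairing F \<gamma> \<Phi> =
    (\<Sum>\<alpha>\<in>Poly_Mapping.keys \<Phi>. Poly_Mapping.lookup \<Phi> \<alpha> * Poly_Mapping.lookup F (\<alpha> + \<gamma>))"

lemma lookup_contract_monomial:
  "Poly_Mapping.lookup (contract_monomial \<alpha> \<beta>) \<gamma> = (if \<beta> = \<alpha> + \<gamma> then 1 else 0)"
proof (cases "expo_le \<alpha> \<beta>")
  case True
  \<comment> \<open>Subtraction of exponents is truncated, so this equivalence depends on the
    divisibility assumed in this case.\<close>
  then have "\<beta> - \<alpha> = \<gamma> \<longleftrightarrow> \<beta> = \<alpha> + \<gamma>"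
    unfolding expo_le_def poly_mapping_eq_iff fun_eq_iff lookup_add lookup_minus
    by (metis add_diff_cancel_left' le_add_diff_inverse)
  with True show ?thesis
    by (simp add: contract_monomial_def lookup_monomial)
next
  case False
  then have "\<beta> \<noteq> \<alpha> + \<gamma>"
    by (auto simp: expo_le_def lookup_add)
  with False show ?thesis
    by (simp add: contract_monomial_def)
qed

lemma lookup_contract: "Poly_Mapping.lookup (contract \<Phi> F) \<gamma> = shifted_pairing F \<gamma> \<Phi>"
proof -
  have "(\<Sum>\<beta>\<in>Poly_Mapping.keys F. c * Poly_Mapping.lookup F \<beta> * (if \<beta> = \<alpha> + \<gamma> then 1 else 0)) =
    c * Poly_Mapping.lookup F (\<alpha> + \<gamma>)" for c \<alpha>
    by (simp add: if_distrib[of "\<lambda>x. _ * x"] in_keys_iff cong: if_cong)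
  then show ?thesis
    by (simp add: contract_def shifted_pairing_def lookup_sum lookup_contract_monomial)
qed

lemma Ann_iff: "\<Phi> \<in> Ann F \<longleftrightarrow> (\<forall>\<gamma>. shifted_pairing F \<gamma> \<Phi> = 0)"
  by (simp add: Ann_def poly_mapping_eq_iff fun_eq_iff lookup_contract)

lemma shifted_pairing_superset:
  assumes "finite K" "Poly_Mapping.keys \<Phi> \<subseteq> K"
  shows "shifted_pairing F \<gamma> \<Phi> =
    (\<Sum>\<alpha>\<in>K. Poly_Mapping.lookup \<Phi> \<alpha> * Poly_Mapping.lookup F (\<alpha> + \<gamma>))"
  unfolding shifted_pairing_def using assms
  by (intro sum.mono_neutral_left) (auto simp: in_keys_iff)

lemma shifted_pairing_add:
  "shifted_pairing F \<gamma> (\<Phi> + \<Psi>) = shifted_pairing F \<gamma> \<Phi> + shifted_pairing F \<gamma> \<Psi>"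
proof -
  let ?K = "Poly_Mapping.keys \<Phi> \<union> Poly_Mapping.keys \<Psi>"
  have "Poly_Mapping.keys (\<Phi> + \<Psi>) \<subseteq> ?K"
    by (rule Poly_Mapping.keys_add)
  then show ?thesis
    by (simp add: shifted_pairing_superset[of ?K] lookup_add distrib_right sum.distrib)
qed

lemma shifted_pairing_single:
  "shifted_pairing F \<gamma> (Poly_Mapping.single \<alpha> c) = c * Poly_Mapping.lookup F (\<alpha> + \<gamma>)"
  by (simp add: shifted_pairing_superset[of "{\<alpha>}"])

lemma shifted_pairing_monomial:
  "shifted_pairing F \<gamma> (monomial \<alpha>) = Poly_Mapping.lookup F (\<alpha> + \<gamma>)"
  by (simp add: monomial_def shifted_pairing_single)

text \<open>A monomial factor of \<Phi> only moves the shift from \<gamma> to \<beta> + \<gamma>.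
  Hence vanishing at all shifts survives multiplication, which makes \<open>Ann F\<close> an
  ideal.\<close>

lemma shifted_pairing_single_times:
  "shifted_pairing F \<gamma> (Poly_Mapping.single \<beta> c * \<Phi>) = c * shifted_pairing F (\<beta> + \<gamma>) \<Phi>"
  by (induction \<Phi> rule: poly_mapping_induct)
     (simp_all add: Poly_Mapping.mult_single shifted_pairing_single shifted_pairing_add
       distrib_left add.assoc add.left_commute mult.assoc)

lemma subspace_Ann: "imod.subspace (Ann F)"
proof (rule imod.subspaceI)
  show "0 \<in> Ann F"
    by (simp add: Ann_iff shifted_pairing_def)
next
  fix \<Phi> \<Psi> assume "\<Phi> \<in> Ann F" "\<Psi> \<in> Ann F"
  then show "\<Phi> + \<Psi> \<in> Ann F"
    by (simp add: Ann_iff shifted_pairing_add)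
next
  fix \<Psi> \<Phi> assume "\<Phi> \<in> Ann F"
  then show "\<Psi> * \<Phi> \<in> Ann F"
    by (induction \<Psi> rule: poly_mapping_induct)
       (simp_all add: Ann_iff shifted_pairing_single_times distrib_right shifted_pairing_add)
qed

section \<open>Spans inside ideals and homogeneous subspaces\<close>

lemma kspan_subset_ideal:
  assumes "imod.subspace I" "B \<subseteq> I"
  shows "kspan B \<subseteq> I"
  unfolding kspan_def using assms
  by (intro kmod.span_minimal kmod.subspaceI)
     (auto simp: scale_eq_times intro: imod.subspace_0 imod.subspace_add imod.subspace_scale)

lemma kspan_base: "b \<in> B \<Longrightarrow> b \<in> kspan B"
  by (simp add: kspan_def kmod.span_base)

lemma kspan_0: "0 \<in> kspan B"
  by (simp add: kspan_def kmod.span_zero)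

lemma subspace_homogeneous: "kmod.subspace (homogeneous d)"
proof (rule kmod.subspaceI)
  fix p q :: "('n, 'k::field) mpoly"
  assume "p \<in> homogeneous d" "q \<in> homogeneous d"
  then show "p + q \<in> homogeneous d"
    using Poly_Mapping.keys_add[of p q] by (auto simp: homogeneous_def)
qed (auto simp: homogeneous_def in_keys_iff)

lemma kspan_homogeneous: "B \<subseteq> homogeneous d \<Longrightarrow> kspan B \<subseteq> homogeneous d"
  unfolding kspan_def by (rule kmod.span_minimal[OF _ subspace_homogeneous])

lemma monomial_homogeneous: "mdeg \<alpha> = d \<Longrightarrow> monomial \<alpha> \<in> homogeneous d"
  by (auto simp: homogeneous_def monomial_def)

subsection \<open>Permutation monomials and the determinant\<close>

definition perm_expo :: "('n::finite \<Rightarrow> 'n) \<Rightarrow> 'n expo" where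
  "perm_expo \<sigma> = (\<Sum>i\<in>UNIV. Poly_Mapping.single (i, \<sigma> i) 1)"

lemma lookup_perm_expo:
  "Poly_Mapping.lookup (perm_expo \<sigma>) (i, j) = (if \<sigma> i = j then 1 else 0)"
proof -
  have "Poly_Mapping.lookup (perm_expo \<sigma>) (i, j) = (\<Sum>k\<in>UNIV. if k = i then if \<sigma> i = j then 1 else 0 else 0)"
    unfolding perm_expo_def lookup_sum
    by (intro sum.cong) (auto simp: lookup_single when_def)
  then show ?thesis
    by simp
qed

lemma perm_expo_eq_iff: "perm_expo \<sigma> = perm_expo \<tau> \<longleftrightarrow> \<sigma> = \<tau>"
proof
  assume eq: "perm_expo \<sigma> = perm_expo \<tau>"
  show "\<sigma> = \<tau>"
  proof
    fix i
    show "\<sigma> i = \<tau> i"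
      using arg_cong[OF eq, of "\<lambda>e. Poly_Mapping.lookup e (i, \<sigma> i)"]
      by (simp add: lookup_perm_expo split: if_splits)
  qed
qed simp

lemma prod_monomial:
  "finite I \<Longrightarrow> (\<Prod>i\<in>I. monomial (f i)) = (monomial (\<Sum>i\<in>I. f i) :: ('n, 'k::field) mpoly)"
proof (induction I rule: finite_induct)
  case empty
  then show ?case by (simp add: monomial_def)
next
  case (insert x I)
  then show ?case by (simp add: monomial_mult)
qed

text \<open>Signs remain units in every characteristic, so the coefficient of a permutation monomial
  in the determinant never vanishes.\<close>

lemma of_int_sign_cases: "of_int (sign \<sigma>) = (1 :: 'a::ring_1) \<or> of_int (sign \<sigma>) = (- 1 :: 'a)"
  by (cases "evenperm \<sigma>") (simp_all add: sign_def)

lemma lookup_of_int_sign_times: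
  "Poly_Mapping.lookup (of_int (sign \<sigma>) * p) \<alpha> =
    of_int (sign \<sigma>) * Poly_Mapping.lookup (p :: ('n, 'k::field) mpoly) \<alpha>"
  by (cases "evenperm \<sigma>") (simp_all add: sign_def)

lemma lookup_det_generic:
  "Poly_Mapping.lookup (det (generic_matrix :: ('n::finite, 'k::field) mpoly ^ 'n ^ 'n)) \<beta> =
    (\<Sum>\<sigma> | \<sigma> permutes UNIV. if perm_expo \<sigma> = \<beta> then of_int (sign \<sigma>) else 0)"
proof -
  have "(\<Prod>i\<in>UNIV. generic_matrix $ i $ \<sigma> i :: ('n, 'k) mpoly) = monomial (perm_expo \<sigma>)" for \<sigma>
    by (simp add: generic_matrix_def var_def perm_expo_def prod_monomial)
  then show ?thesis
    by (auto simp: det_def lookup_sum lookup_of_int_sign_times lookup_monomial intro!: sum.cong)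
qed

lemma lookup_det_perm_expo:
  assumes "\<sigma> permutes UNIV"
  shows "Poly_Mapping.lookup (det (generic_matrix :: ('n::finite, 'k::field) mpoly ^ 'n ^ 'n))
    (perm_expo \<sigma>) = of_int (sign \<sigma>)"
  using assms by (simp add: lookup_det_generic perm_expo_eq_iff)

lemma lookup_det_nonzeroE:
  assumes "Poly_Mapping.lookup (det (generic_matrix :: ('n::finite, 'k::field) mpoly ^ 'n ^ 'n)) \<beta> \<noteq> 0"
  obtains \<sigma> where "\<sigma> permutes UNIV" "\<beta> = perm_expo \<sigma>"
proof -
  from assms obtain \<sigma> where "\<sigma> \<in> {\<sigma>. \<sigma> permutes UNIV}"
      "(if perm_expo \<sigma> = \<beta> then of_int (sign \<sigma>) else 0 :: 'k) \<noteq> 0"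
    unfolding lookup_det_generic by (rule sum.not_neutral_contains_not_neutral)
  with that show ?thesis
    by (auto split: if_splits)
qed

text \<open>The cofactor \<gamma> is forced to be the part of the permutation monomial outside rows
  i and k, and precomposing with the transposition leaves that part unchanged.\<close>

lemma perm_expo_swap:
  fixes \<sigma> :: "'n::finite \<Rightarrow> 'n"
  assumes "i \<noteq> k"
    and "Poly_Mapping.single (i, \<sigma> i) 1 + Poly_Mapping.single (k, \<sigma> k) 1 + \<gamma> = perm_expo \<sigma>"
  shows "Poly_Mapping.single (i, \<sigma> k) 1 + Poly_Mapping.single (k, \<sigma> i) 1 + \<gamma> =
    perm_expo (\<sigma> \<circ> Transposition.transpose i k)"
proof -
  let ?rest = "\<lambda>\<tau>. \<Sum>r\<in>UNIV - {i, k}. Poly_Mapping.single (r, \<tau> r) (1::nat)"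
  have split: "perm_expo \<tau> = Poly_Mapping.single (i, \<tau> i) 1 + Poly_Mapping.single (k, \<tau> k) 1 + ?rest \<tau>"
    for \<tau> :: "'n \<Rightarrow> 'n"
  proof -
    have "perm_expo \<tau> = (\<Sum>r\<in>{i, k}. Poly_Mapping.single (r, \<tau> r) 1) + ?rest \<tau>"
      unfolding perm_expo_def by (subst add.commute, rule sum.subset_diff) auto
    then show ?thesis using \<open>i \<noteq> k\<close> by simp
  qed
  have "\<gamma> = ?rest \<sigma>"
    using assms(2) unfolding split[of \<sigma>] by simp
  also have "\<dots> = ?rest (\<sigma> \<circ> Transposition.transpose i k)"
    by (intro sum.cong) auto
  finally show ?thesis
    unfolding split[of "\<sigma> \<circ> Transposition.transpose i k"] by simp
qed

lemma sign_comp_transpose: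
  fixes \<sigma> :: "'n::finite \<Rightarrow> 'n"
  assumes "\<sigma> permutes UNIV" "i \<noteq> k"
  shows "sign (\<sigma> \<circ> Transposition.transpose i k) = - sign \<sigma>"
  using sign_compose[OF permutes_imp_permutation[OF finite assms(1)] permutation_swap_id] assms(2)
  by (simp add: sign_swap_id)

lemma comp_transpose_permutes:
  "\<sigma> permutes UNIV \<Longrightarrow> \<sigma> \<circ> Transposition.transpose i k permutes UNIV"
  by (simp add: permutes_compose permutes_swap_id)

subsection \<open>The generators annihilate the determinant\<close>

text \<open>A divisor of a permutation monomial is square free and supported on the graph of
  \<sigma>, which by injectivity meets each row and each column only once.\<close>

lemma acceptable_if_completes:
  assumes "\<sigma> permutes UNIV" "\<alpha> + \<gamma> = perm_expo \<sigma>"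
  shows "acceptable \<alpha>"
proof -
  have le: "Poly_Mapping.lookup \<alpha> (i, j) \<le> (if \<sigma> i = j then 1 else 0)" for i j
    by (simp add: assms(2)[symmetric] lookup_perm_expo[symmetric] lookup_add)
  have graph: "snd v = \<sigma> (fst v)" if "v \<in> Poly_Mapping.keys \<alpha>" for v
    using le[of "fst v" "snd v"] that by (auto simp: in_keys_iff split: if_splits)
  have "fst v \<noteq> fst w \<and> snd v \<noteq> snd w"
    if "v \<in> Poly_Mapping.keys \<alpha>" "w \<in> Poly_Mapping.keys \<alpha>" "v \<noteq> w" for v w
    using graph[OF that(1)] graph[OF that(2)] that(3) permutes_inj[OF assms(1)]
    by (metis injD prod_eqI)
  moreover have "Poly_Mapping.lookup \<alpha> v \<le> 1" for v
    using le[of "fst v" "snd v"] by (auto split: if_splits)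
  ultimately show ?thesis
    by (simp add: acceptable_def)
qed

lemma unacceptable_in_Ann:
  assumes "\<not> acceptable \<alpha>"
  shows "monomial \<alpha> \<in> Ann (det generic_matrix)"
  unfolding Ann_iff shifted_pairing_monomial
  using assms by (blast elim: lookup_det_nonzeroE dest: acceptable_if_completes)

text \<open>A nonzero coefficient comes from a permutation through (i, j) and (k, l). Exchanging the
  two columns composes it with a transposition and so reverses its sign.\<close>

lemma lookup_det_swap:
  fixes i k j l :: "'n::finite"
  assumes "i \<noteq> k"
    and "Poly_Mapping.lookup (det (generic_matrix :: ('n, 'k::field) mpoly ^ 'n ^ 'n))
      (Poly_Mapping.single (i, j) 1 + Poly_Mapping.single (k, l) 1 + \<gamma>) \<noteq> 0"
  shows "Poly_Mapping.lookup (det (generic_matrix :: ('n, 'k) mpoly ^ 'n ^ 'n))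
      (Poly_Mapping.single (i, l) 1 + Poly_Mapping.single (k, j) 1 + \<gamma>) =
    - Poly_Mapping.lookup (det (generic_matrix :: ('n, 'k) mpoly ^ 'n ^ 'n))
      (Poly_Mapping.single (i, j) 1 + Poly_Mapping.single (k, l) 1 + \<gamma>)"
proof -
  from assms(2) obtain \<sigma> where \<sigma>: "\<sigma> permutes UNIV"
      "Poly_Mapping.single (i, j) 1 + Poly_Mapping.single (k, l) 1 + \<gamma> = perm_expo \<sigma>"
    by (rule lookup_det_nonzeroE)
  have "Poly_Mapping.lookup (perm_expo \<sigma>) (i, j) \<noteq> 0" "Poly_Mapping.lookup (perm_expo \<sigma>) (k, l) \<noteq> 0"
    by (simp_all add: \<sigma>(2)[symmetric] lookup_add)
  then have jl: "\<sigma> i = j" "\<sigma> k = l"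
    by (simp_all add: lookup_perm_expo split: if_splits)
  have "Poly_Mapping.single (i, l) 1 + Poly_Mapping.single (k, j) 1 + \<gamma> = perm_expo (\<sigma> \<circ> Transposition.transpose i k)"
    using perm_expo_swap[of i k \<sigma> \<gamma>] \<sigma>(2) assms(1) jl by simp
  then show ?thesis
    unfolding \<sigma>(2)
    by (simp add: lookup_det_perm_expo \<sigma>(1) comp_transpose_permutes sign_comp_transpose assms(1)
        del: One_nat_def)
qed

lemma permanent_eq_monomials:
  "(generic_matrix $ i $ j * generic_matrix $ k $ l :: ('n::finite, 'k::field) mpoly) =
    monomial (Poly_Mapping.single (i, j) 1 + Poly_Mapping.single (k, l) 1)"
  by (simp add: generic_matrix_def var_def monomial_mult)

lemma permanent_in_Ann:
  fixes i k j l :: "'n::finite"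
  assumes "i \<noteq> k"
  shows "generic_matrix $ i $ j * generic_matrix $ k $ l + generic_matrix $ i $ l * generic_matrix $ k $ j
    \<in> Ann (det (generic_matrix :: ('n, 'k::field) mpoly ^ 'n ^ 'n))"
  unfolding Ann_iff permanent_eq_monomials shifted_pairing_add shifted_pairing_monomial
proof
  fix \<gamma>
  let ?c = "\<lambda>j l. Poly_Mapping.lookup (det (generic_matrix :: ('n, 'k) mpoly ^ 'n ^ 'n))
    (Poly_Mapping.single (i, j) 1 + Poly_Mapping.single (k, l) 1 + \<gamma>)"
  \<comment> \<open>Either both coefficients vanish, or a nonzero one forces the other to be its
    negative; the swap is symmetric in j and l.\<close>
  have "?c j l \<noteq> 0 \<Longrightarrow> ?c l j = - ?c j l" "?c l j \<noteq> 0 \<Longrightarrow> ?c j l = - ?c l j"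
    by (rule lookup_det_swap[OF assms], assumption)+
  then show "?c j l + ?c l j = 0"
    by (metis add.left_inverse add.right_inverse add.right_neutral)
qed

abbreviation det_ideal :: "('n::finite, 'k::field) mpoly set" where
  "det_ideal \<equiv> ideal_gen (perm_space generic_matrix + unacceptable_space)"

lemma det_ideal_subset_Ann: "det_ideal \<subseteq> Ann (det generic_matrix)"
proof -
  have "perm_space generic_matrix \<subseteq> Ann (det generic_matrix)"
    unfolding perm_space_def by (intro kspan_subset_ideal[OF subspace_Ann]) (auto intro: permanent_in_Ann)
  moreover have "unacceptable_space \<subseteq> Ann (det generic_matrix)"
    unfolding unacceptable_space_def
    by (intro kspan_subset_ideal[OF subspace_Ann]) (auto intro: unacceptable_in_Ann)
  ultimately show ?thesis
    unfolding ideal_gen_def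
    by (intro imod.span_minimal subspace_Ann) (auto elim!: set_plus_elim intro: imod.subspace_add[OF subspace_Ann])
qed

subsection \<open>Reduction modulo the generators\<close>

lemma det_ideal_add: "p \<in> det_ideal \<Longrightarrow> q \<in> det_ideal \<Longrightarrow> p + q \<in> det_ideal"
  by (simp add: ideal_gen_def imod.span_add)

lemma det_ideal_times: "p \<in> det_ideal \<Longrightarrow> q * p \<in> det_ideal"
  by (simp add: ideal_gen_def imod.span_scale)

lemma permanent_in_det_ideal:
  assumes "i \<noteq> k" "j \<noteq> l"
  shows "monomial (Poly_Mapping.single (i, j) 1 + Poly_Mapping.single (k, l) 1)
    + monomial (Poly_Mapping.single (i, l) 1 + Poly_Mapping.single (k, j) 1)
    \<in> (det_ideal :: ('n::finite, 'k::field) mpoly set)" (is "?p \<in> _")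
proof -
  have "?p \<in> perm_space generic_matrix"
    unfolding perm_space_def permanent_eq_monomials using assms by (intro kspan_base) blast
  \<comment> \<open>The generating set is an elementwise sum of two subspaces; adding 0 from the
    other one shows that it contains each of them.\<close>
  from set_plus_intro[OF this, of 0 unacceptable_space] show ?thesis
    by (simp add: ideal_gen_def imod.span_base unacceptable_space_def kspan_0)
qed

lemma unacceptable_quadric_in_det_ideal:
  assumes "mdeg \<alpha> = 2" "\<not> acceptable \<alpha>"
  shows "monomial \<alpha> \<in> (det_ideal :: ('n::finite, 'k::field) mpoly set)"
proof -
  have "monomial \<alpha> \<in> (unacceptable_space :: ('n, 'k) mpoly set)"
    unfolding unacceptable_space_def using assms by (intro kspan_base) blast
  from set_plus_intro[OF _ this, of 0 "perm_space generic_matrix"] show ?thesis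
    by (simp add: ideal_gen_def imod.span_base perm_space_def kspan_0)
qed

text \<open>Unacceptability has a witness of degree two: the square of a variable, or the product of
  two distinct variables sharing a row or a column.\<close>

lemma unacceptable_has_quadric:
  assumes "\<not> acceptable \<alpha>"
  obtains \<beta> \<delta> where "\<alpha> = \<delta> + \<beta>" "mdeg \<beta> = 2" "\<not> acceptable \<beta>"
proof -
  have "\<exists>v w. \<not> acceptable (Poly_Mapping.single v 1 + Poly_Mapping.single w 1) \<and>
    (\<forall>u. Poly_Mapping.lookup (Poly_Mapping.single v 1 + Poly_Mapping.single w 1) u
      \<le> Poly_Mapping.lookup \<alpha> u)"
  proof (cases "\<exists>v. Poly_Mapping.lookup \<alpha> v > 1")
    case True
    then obtain v where v: "Poly_Mapping.lookup \<alpha> v > 1" by blast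
    have "\<not> acceptable (Poly_Mapping.single v 1 + Poly_Mapping.single v 1)"
      unfolding acceptable_def not_all de_Morgan_conj by (intro disjI1 exI[of _ v]) (simp add: lookup_add)
    with v show ?thesis
      by (intro exI[of _ v]) (auto simp: lookup_add lookup_single when_def)
  next
    case False
    with assms obtain v w where vw: "v \<in> Poly_Mapping.keys \<alpha>" "w \<in> Poly_Mapping.keys \<alpha>"
        "v \<noteq> w" "fst v = fst w \<or> snd v = snd w"
      unfolding acceptable_def by (auto simp: not_less)
    have "v \<in> Poly_Mapping.keys (Poly_Mapping.single v 1 + Poly_Mapping.single w (1::nat))"
      "w \<in> Poly_Mapping.keys (Poly_Mapping.single v 1 + Poly_Mapping.single w (1::nat))"
      by (simp_all add: in_keys_iff lookup_add)
    with vw have "\<not> acceptable (Poly_Mapping.single v 1 + Poly_Mapping.single w 1)"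
      unfolding acceptable_def by blast
    with vw show ?thesis
      by (intro exI[of _ v] exI[of _ w]) (auto simp: lookup_add lookup_single when_def in_keys_iff)
  qed
  then obtain \<beta> where \<beta>: "mdeg \<beta> = 2" "\<not> acceptable \<beta>"
      "\<And>u. Poly_Mapping.lookup \<beta> u \<le> Poly_Mapping.lookup \<alpha> u"
    by (metis mdeg_add mdeg_single one_add_one)
  \<comment> \<open>The truncated difference is an exact quotient because \<beta> divides
    \<alpha>.\<close>
  then have "\<alpha> = (\<alpha> - \<beta>) + \<beta>"
    by (intro poly_mapping_eqI) (simp add: lookup_add lookup_minus)
  with \<beta> that show thesis by blast
qed

lemma unacceptable_in_det_ideal:
  assumes "\<not> acceptable \<alpha>"
  shows "monomial \<alpha> \<in> det_ideal"
proof -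
  from assms obtain \<beta> \<delta> where "\<alpha> = \<delta> + \<beta>" "mdeg \<beta> = 2" "\<not> acceptable \<beta>"
    by (rule unacceptable_has_quadric)
  then show ?thesis
    by (simp add: monomial_mult unacceptable_quadric_in_det_ideal det_ideal_times)
qed

section \<open>Congruence of monomials that share a complement \<gamma>\<close>

lemma lookup_completed_row:
  assumes "\<alpha> + \<gamma> = perm_expo \<sigma>" "\<alpha>' + \<gamma> = perm_expo \<sigma>'" "\<sigma> i \<noteq> \<sigma>' i"
  shows "Poly_Mapping.lookup \<alpha> (i, \<sigma> i) = 1"
proof -
  \<comment> \<open>Since \<gamma> also divides the monomial of \<sigma>', which avoids (i, \<sigma>
    i), this variable cannot come from \<gamma> and must lie in \<alpha>.\<close>
  have "Poly_Mapping.lookup (\<alpha>' + \<gamma>) (i, \<sigma> i) = 0"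
    using assms(3) by (simp add: assms(2) lookup_perm_expo)
  moreover have "Poly_Mapping.lookup (\<alpha> + \<gamma>) (i, \<sigma> i) = 1"
    by (simp add: assms(1) lookup_perm_expo)
  ultimately show ?thesis
    by (simp add: lookup_add)
qed

text \<open>Induction on the number of rows where \<sigma> and \<sigma>' differ. A transposition
  repairs one row, and the sign weights absorb the change of sign it causes modulo the
  permanents.\<close>

lemma completed_monomials_congruent:
  fixes \<sigma> \<sigma>' :: "'n::finite \<Rightarrow> 'n"
  assumes "\<sigma> permutes UNIV" "\<sigma>' permutes UNIV"
    and "\<alpha> + \<gamma> = perm_expo \<sigma>" "\<alpha>' + \<gamma> = perm_expo \<sigma>'"
  shows "of_int (sign \<sigma>) * monomial \<alpha> - of_int (sign \<sigma>') * monomial \<alpha>'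
    \<in> (det_ideal :: ('n, 'k::field) mpoly set)"
  using assms
proof (induction "card {i. \<sigma> i \<noteq> \<sigma>' i}" arbitrary: \<sigma> \<alpha> rule: less_induct)
  case less
  note \<sigma> = less.prems(1) and \<sigma>' = less.prems(2) and \<alpha> = less.prems(3) and \<alpha>' = less.prems(4)
  show ?case
  proof (cases "\<sigma> = \<sigma>'")
    case True
    with \<alpha> \<alpha>' have "\<alpha> = \<alpha>'" by (metis add_right_cancel)
    with True show ?thesis
      by (simp add: ideal_gen_def imod.span_zero)
  next
    case False
    then obtain i where i: "\<sigma> i \<noteq> \<sigma>' i" by blast
    \<comment> \<open>Row k holds the column that \<sigma>' assigns to row i, so swapping rows i and
      k makes row i agree with \<sigma>'.\<close>
    obtain k where k: "\<sigma> k = \<sigma>' i"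
      using permutes_surj[OF \<sigma>] by (metis surjD)
    have ik: "i \<noteq> k" using i k by auto
    \<comment> \<open>Row k was already a row of disagreement, so the swap spoils no agreement and
      the count drops.\<close>
    have k': "\<sigma> k \<noteq> \<sigma>' k"
      using permutes_inj[OF \<sigma>'] ik k by (auto simp: inj_eq)
    define \<tau> where "\<tau> = \<sigma> \<circ> Transposition.transpose i k"
    have \<tau>: "\<tau> permutes UNIV"
      unfolding \<tau>_def using \<sigma> by (rule comp_transpose_permutes)
    have "{r. \<tau> r \<noteq> \<sigma>' r} \<subseteq> {r. \<sigma> r \<noteq> \<sigma>' r} - {i}"
      using k k' by (auto simp: \<tau>_def Transposition.transpose_def)
    then have card: "card {r. \<tau> r \<noteq> \<sigma>' r} < card {r. \<sigma> r \<noteq> \<sigma>' r}"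
      using i by (intro psubset_card_mono) auto
    \<comment> \<open>Rows i and k are both rows of disagreement, so \<alpha> contains both
      variables and this quotient is exact.\<close>
    define \<delta> where "\<delta> = \<alpha> - (Poly_Mapping.single (i, \<sigma> i) 1 + Poly_Mapping.single (k, \<sigma> k) 1)"
    have "Poly_Mapping.lookup \<alpha> (i, \<sigma> i) = 1" "Poly_Mapping.lookup \<alpha> (k, \<sigma> k) = 1"
      using lookup_completed_row[OF \<alpha> \<alpha>'] i k' by blast+
    then have \<alpha>_eq: "\<alpha> = \<delta> + (Poly_Mapping.single (i, \<sigma> i) 1 + Poly_Mapping.single (k, \<sigma> k) 1)"
      using ik unfolding \<delta>_def
      by (intro poly_mapping_eqI) (auto simp: lookup_add lookup_minus lookup_single when_def)
    define \<beta> where "\<beta> = \<delta> + (Poly_Mapping.single (i, \<sigma> k) 1 + Poly_Mapping.single (k, \<sigma> i) 1)"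
    have "\<beta> + \<gamma> = perm_expo \<tau>"
      using perm_expo_swap[OF ik, of \<sigma> "\<delta> + \<gamma>"] \<alpha> unfolding \<tau>_def \<alpha>_eq \<beta>_def
      by (simp add: ac_simps)
    from less.hyps[OF card \<tau> \<sigma>' this \<alpha>']
    have IH: "of_int (sign \<tau>) * monomial \<beta> - of_int (sign \<sigma>') * monomial \<alpha>'
      \<in> (det_ideal :: ('n, 'k) mpoly set)" .
    have "\<sigma> i \<noteq> \<sigma> k"
      using i k by simp
    then have "monomial \<alpha> + monomial \<beta> \<in> (det_ideal :: ('n, 'k) mpoly set)"
      unfolding \<alpha>_eq \<beta>_def monomial_mult[of \<delta>] distrib_left[symmetric]
      using ik by (intro det_ideal_times permanent_in_det_ideal)
    \<comment> \<open>As \<tau> has the opposite sign to \<sigma>, the two multiples of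
      \<open>monomial \<beta>\<close> cancel in this sum.\<close>
    from det_ideal_add[OF det_ideal_times[OF this, of "of_int (sign \<sigma>)"] IH]
    show ?thesis
      by (simp add: \<tau>_def sign_comp_transpose[OF \<sigma> ik] algebra_simps)
  qed
qed

section \<open>Completing acceptable monomials to permutation monomials\<close>

lemma inj_on_extends_to_permutation:
  fixes f :: "'n::finite \<Rightarrow> 'n"
  assumes "inj_on f P"
  obtains \<sigma> where "\<sigma> permutes UNIV" "\<And>i. i \<in> P \<Longrightarrow> \<sigma> i = f i"
proof -
  \<comment> \<open>By injectivity P and its image have equal size, hence so do their complements; a
    bijection between these is glued to f.\<close>
  have "card (- P) = card (- f ` P)"
    using card_image[OF assms] by (simp add: Compl_eq_Diff_UNIV card_Diff_subset)
  then obtain g where g: "bij_betw g (- P) (- f ` P)"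
    by (metis finite finite_same_card_bij)
  define \<sigma> where "\<sigma> i = (if i \<in> P then f i else g i)" for i
  have "bij_betw \<sigma> (P \<union> - P) (f ` P \<union> - f ` P)"
  proof (rule bij_betw_combine)
    show "bij_betw \<sigma> P (f ` P)"
      using assms by (simp add: \<sigma>_def bij_betw_def cong: inj_on_cong)
    show "bij_betw \<sigma> (- P) (- f ` P)"
      using g by (subst bij_betw_cong[of _ _ g]) (auto simp: \<sigma>_def)
  qed auto
  then have "\<sigma> permutes UNIV"
    by (intro bij_imp_permutes) auto
  with that show thesis
    by (simp add: \<sigma>_def)
qed

lemma acceptable_completes:
  fixes \<alpha> :: "'n::finite expo"
  assumes "acceptable \<alpha>"
  obtains \<gamma> \<sigma> where "\<sigma> permutes UNIV" "\<alpha> + \<gamma> = perm_expo \<sigma>"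
proof -
  let ?K = "Poly_Mapping.keys \<alpha>"
  \<comment> \<open>Acceptability allows at most one column per row, so on the occupied rows the
    choice is forced; f is injective there because no column repeats.\<close>
  define f where "f i = (SOME j. (i, j) \<in> ?K)" for i
  have f: "f i = j" if "(i, j) \<in> ?K" for i j
    unfolding f_def using that assms by (intro some_equality) (fastforce simp: acceptable_def)+
  have "inj_on f (fst ` ?K)"
  proof (rule inj_onI)
    fix i k assume "i \<in> fst ` ?K" "k \<in> fst ` ?K" "f i = f k"
    then have "(i, f i) \<in> ?K" "(k, f i) \<in> ?K"
      using f by fastforce+
    with assms show "i = k"
      by (fastforce simp: acceptable_def)
  qed
  then obtain \<sigma> where \<sigma>: "\<sigma> permutes UNIV" "\<And>i. i \<in> fst ` ?K \<Longrightarrow> \<sigma> i = f i"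
    by (rule inj_on_extends_to_permutation) blast
  have "Poly_Mapping.lookup \<alpha> v \<le> Poly_Mapping.lookup (perm_expo \<sigma>) v" for v
  proof (cases "v \<in> ?K")
    case True
    then have "\<sigma> (fst v) = snd v"
      using \<sigma>(2) f by (metis imageI prod.collapse)
    then have "Poly_Mapping.lookup (perm_expo \<sigma>) v = 1"
      using lookup_perm_expo[of \<sigma> "fst v" "snd v"] by simp
    moreover have "Poly_Mapping.lookup \<alpha> v \<le> 1"
      using assms unfolding acceptable_def by blast
    ultimately show ?thesis
      by simp
  qed (simp add: in_keys_iff)
  then have "\<alpha> + (perm_expo \<sigma> - \<alpha>) = perm_expo \<sigma>"
    by (intro poly_mapping_eqI) (simp add: lookup_add lookup_minus)
  with \<sigma>(1) that show thesis by blast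
qed

section \<open>Eliminating terms of a polynomial that annihilates the determinant\<close>

lemma Ann_det_partner:
  assumes "\<Phi> \<in> Ann (det (generic_matrix :: ('n::finite, 'k::field) mpoly ^ 'n ^ 'n))"
    and "\<alpha> \<in> Poly_Mapping.keys \<Phi>" "\<sigma> permutes UNIV" "\<alpha> + \<gamma> = perm_expo \<sigma>"
  obtains \<alpha>' \<sigma>' where "\<alpha>' \<in> Poly_Mapping.keys \<Phi>" "\<alpha>' \<noteq> \<alpha>" "\<sigma>' permutes UNIV" "\<alpha>' + \<gamma> = perm_expo \<sigma>'"
proof -
  let ?F = "det (generic_matrix :: ('n, 'k) mpoly ^ 'n ^ 'n)"
  let ?t = "\<lambda>\<alpha>. Poly_Mapping.lookup \<Phi> \<alpha> * Poly_Mapping.lookup ?F (\<alpha> + \<gamma>)"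
  have "shifted_pairing ?F \<gamma> \<Phi> = ?t \<alpha> + sum ?t (Poly_Mapping.keys \<Phi> - {\<alpha>})"
    unfolding shifted_pairing_def using assms(2) by (intro sum.remove) auto
  then have "?t \<alpha> + sum ?t (Poly_Mapping.keys \<Phi> - {\<alpha>}) = 0"
    using assms(1) by (simp add: Ann_iff)
  \<comment> \<open>The term of \<alpha> is its coefficient times a sign, so another nonzero term
    must compensate for it in the vanishing sum.\<close>
  moreover have "?t \<alpha> \<noteq> 0"
    using assms(2-4) of_int_sign_cases[of \<sigma>, where 'a='k]
    by (auto simp: lookup_det_perm_expo in_keys_iff)
  ultimately have "sum ?t (Poly_Mapping.keys \<Phi> - {\<alpha>}) \<noteq> 0"
    by (metis add.right_neutral)
  then obtain \<alpha>' where \<alpha>': "\<alpha>' \<in> Poly_Mapping.keys \<Phi> - {\<alpha>}" "?t \<alpha>' \<noteq> 0"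
    by (rule sum.not_neutral_contains_not_neutral)
  then have "Poly_Mapping.lookup ?F (\<alpha>' + \<gamma>) \<noteq> 0"
    by simp
  with \<alpha>'(1) that show thesis
    by (metis DiffE insertI1 lookup_det_nonzeroE)
qed

lemma eliminate_term:
  fixes \<Phi> :: "('n::finite, 'k::field) mpoly"
  assumes "\<Phi> \<in> Ann (det generic_matrix)" "\<Phi> \<noteq> 0"
  obtains p where "p \<in> det_ideal" "Poly_Mapping.keys (\<Phi> - p) \<subset> Poly_Mapping.keys \<Phi>"
proof -
  obtain \<alpha> where \<alpha>: "\<alpha> \<in> Poly_Mapping.keys \<Phi>"
    using assms(2) by (metis all_not_in_conv keys_eq_empty)
  show thesis
  proof (cases "acceptable \<alpha>")
    case False
    \<comment> \<open>An unacceptable term lies in the ideal by itself and is removed whole.\<close>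
    let ?p = "Poly_Mapping.single 0 (Poly_Mapping.lookup \<Phi> \<alpha>) * monomial \<alpha>"
    have "Poly_Mapping.keys (\<Phi> - ?p) \<subset> Poly_Mapping.keys \<Phi>"
      using \<alpha> by (auto simp: scale_eq_times[symmetric] in_keys_iff lookup_minus lookup_monomial split: if_splits)
    with that False show thesis
      using det_ideal_times unacceptable_in_det_ideal by blast
  next
    case True
    then obtain \<gamma> \<sigma> where \<sigma>: "\<sigma> permutes UNIV" "\<alpha> + \<gamma> = perm_expo \<sigma>"
      by (rule acceptable_completes)
    from assms(1) \<alpha> this obtain \<alpha>' \<sigma>' where \<alpha>': "\<alpha>' \<in> Poly_Mapping.keys \<Phi>" "\<alpha>' \<noteq> \<alpha>"
        "\<sigma>' permutes UNIV" "\<alpha>' + \<gamma> = perm_expo \<sigma>'"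
      by (rule Ann_det_partner)
    let ?q = "of_int (sign \<sigma>') * monomial \<alpha>' - of_int (sign \<sigma>) * monomial \<alpha> :: ('n, 'k) mpoly"
    \<comment> \<open>The factor is chosen so that the coefficient at \<alpha>' is that of \<Phi>,
      the sign squaring to 1. The only other exponent involved is \<alpha>, already a key of \<Phi>,
      so no new term appears.\<close>
    let ?p = "Poly_Mapping.single 0 (Poly_Mapping.lookup \<Phi> \<alpha>' * of_int (sign \<sigma>')) * ?q"
    have "of_int (sign \<sigma>') * of_int (sign \<sigma>') = (1 :: 'k)"
      using of_int_sign_cases[of \<sigma>', where 'a='k] by auto
    then have "\<alpha>' \<notin> Poly_Mapping.keys (\<Phi> - ?p)"
      using \<alpha>'(2) by (simp add: scale_eq_times[symmetric] in_keys_iff lookup_minus lookup_monomial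
          lookup_of_int_sign_times mult.assoc)
    moreover have "Poly_Mapping.keys (\<Phi> - ?p) \<subseteq> Poly_Mapping.keys \<Phi>"
      using \<alpha> \<alpha>'(1) by (auto simp: scale_eq_times[symmetric] in_keys_iff lookup_minus lookup_monomial
          lookup_of_int_sign_times split: if_splits)
    ultimately have "Poly_Mapping.keys (\<Phi> - ?p) \<subset> Poly_Mapping.keys \<Phi>"
      using \<alpha>'(1) by blast
    with that show thesis
      using det_ideal_times[OF completed_monomials_congruent[OF \<alpha>'(3) \<sigma>(1) \<alpha>'(4) \<sigma>(2)]] by blast
  qed
qed

lemma Ann_subset_det_ideal:
  fixes \<Phi> :: "('n::finite, 'k::field) mpoly"
  assumes "\<Phi> \<in> Ann (det generic_matrix)"
  shows "\<Phi> \<in> det_ideal"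
  using assms
proof (induction "card (Poly_Mapping.keys \<Phi>)" arbitrary: \<Phi> rule: less_induct)
  case less
  show ?case
  proof (cases "\<Phi> = 0")
    case True
    then show ?thesis
      by (simp add: ideal_gen_def imod.span_zero)
  next
    case False
    with less.prems obtain p where p: "p \<in> det_ideal"
        "Poly_Mapping.keys (\<Phi> - p) \<subset> Poly_Mapping.keys \<Phi>"
      by (rule eliminate_term)
    \<comment> \<open>The inclusion proved first keeps the remainder in the annihilator, so the
      induction on the number of terms can continue.\<close>
    have "\<Phi> - p \<in> Ann (det generic_matrix)"
      using less.prems p(1) det_ideal_subset_Ann imod.subspace_diff[OF subspace_Ann] by blast
    with p(2) have "\<Phi> - p \<in> det_ideal"
      by (intro less.hyps psubset_card_mono) auto
    from det_ideal_add[OF this p(1)] show ?thesis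
      by simp
  qed
qed

section \<open>Degree of the generators and conclusion\<close>

lemma generators_homogeneous:
  "perm_space generic_matrix + unacceptable_space \<subseteq> (homogeneous 2 :: ('n::finite, 'k::field) mpoly set)"
proof -
  have "perm_space generic_matrix \<subseteq> (homogeneous 2 :: ('n, 'k) mpoly set)"
    unfolding perm_space_def permanent_eq_monomials
    by (intro kspan_homogeneous)
       (auto intro!: kmod.subspace_add[OF subspace_homogeneous] monomial_homogeneous simp: mdeg_add)
  moreover have "unacceptable_space \<subseteq> (homogeneous 2 :: ('n, 'k) mpoly set)"
    unfolding unacceptable_space_def by (intro kspan_homogeneous) (auto intro: monomial_homogeneous)
  ultimately show ?thesis
    by (auto elim!: set_plus_elim intro!: kmod.subspace_add[OF subspace_homogeneous])
qed

theorem theorem2p12: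
  fixes A D :: "('n::finite, 'k::field) mpoly ^ 'n ^ 'n"
  assumes "CHAR('k) = 0 \<or> CHAR('k) > 2"
    and "A = generic_matrix" and "D = generic_matrix"
  shows "Ann (det A) = ideal_gen (perm_space D + unacceptable_space)
    \<and> generated_in_degree 2 (Ann (det A))"
proof -
  have "Ann (det A) = ideal_gen (perm_space D + unacceptable_space)"
    unfolding assms(2,3) using det_ideal_subset_Ann Ann_subset_det_ideal by blast
  moreover have "perm_space D + unacceptable_space \<subseteq> homogeneous 2"
    unfolding assms(3) by (rule generators_homogeneous)
  ultimately show ?thesis
    unfolding generated_in_degree_def by blast
qed

end
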